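(* Let $s\in\{+1,-1\}$ and $p\in(1,\infty)$. Let $f\in PW_1$ be nonzero with $\widehat f(0)=0$, and assume $\mathcal H(f)\in L^1(\mathbb R)$. Suppose there exist $r_1,r_2>0$ such that $f(y)\ge0$ for $|y|\ge r_1$ and $s\mathcal H(f)(x)\ge0$ for $|x|\ge r_2$. Then $$r_1^{1/p'}\,r_2^{1/p}\ \ge\ 2^{-(p'+2)}\,C_p^{-\frac{p+1}{p-1}},$$ where $p'=p/(p-1)$, $C_p=\tan(\frac{\pi}{2p})$ if $1<p\le2$ and $C_p=\cot(\frac{\pi}{2p})$ if $2<p<\infty$.
   Context: $\widehat f(\xi)=\int_{\mathbb R}f(x)e^{-2\pi ix\xi}dx$. $PW_1$ is the set of real-valued continuous $f\in L^1(\mathbb R)$ with $\operatorname{supp}\widehat f\subseteq[-1,1]$. $\mathcal H$ is the Hilbert transform, $\mathcal H(f)=\mathrm{p.v.}\,f*\frac{1}{\pi x}$, so that $\widehat{\mathcal H(f)}(\xi)=-i\,\mathrm{sign}(\xi)\widehat f(\xi)$. *)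

theory Defs
  imports "HOL-Analysis.Analysis"
begin

definition fourier :: "(real \<Rightarrow> real) \<Rightarrow> real \<Rightarrow> complex" where
  "fourier f \<xi> = integral\<^sup>L lborel (\<lambda>x. complex_of_real (f x) * cis (- 2 * pi * x * \<xi>))"

definition PW1 :: "(real \<Rightarrow> real) set" where
  "PW1 = {f. continuous_on UNIV f \<and> integrable lborel f \<and>
             closure {\<xi>. fourier f \<xi> \<noteq> 0} \<subseteq> {-1..1}}"

definition hilbert :: "(real \<Rightarrow> real) \<Rightarrow> real \<Rightarrow> real" where
  "hilbert f x = Lim (at_right 0)
     (\<lambda>\<epsilon>. (1 / pi) * set_lebesgue_integral lborel {y. \<epsilon> < \<bar>y\<bar>} (\<lambda>y. f (x - y) / y))"

definition Cconst :: "real \<Rightarrow> real" where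
  "Cconst p = (if p \<le> 2 then tan (pi / (2 * p)) else cot (pi / (2 * p)))"

end

theory Submission
  imports Defs "HOL-Probability.Sinc_Integral" "HOL-Probability.Characteristic_Functions"
begin

text \<open>
  Both radii are at least 1/8, whatever \<open>p\<close> is. If \<open>g\<close> is integrable with mean zero and its
  Fourier transform is supported in [-1, 1], then Fourier inversion gives
  \<open>sup |g| \<le> 2 \<parallel>g\<parallel>\<close> (L1 norm). If moreover \<open>g \<ge> 0\<close> outside [-r, r], then
  \<open>\<parallel>g\<parallel> = \<integral> (|g| - g) \<le> 2 r \<sqdot> 2 sup |g| \<le> 8 r \<parallel>g\<parallel>\<close>. This applies to \<open>f\<close> and to
  \<open>s \<H> f\<close>: since the transform of \<open>f\<close> vanishes at 0, the multiplier \<open>- i sgn\<close> keeps it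
  continuous, so inversion is available for \<open>\<H> f\<close> too. As \<open>p' \<ge> 1\<close> and
  \<open>C\<^sub>p \<ge> 1\<close>, the claimed bound never exceeds 1/8, the weighted geometric mean of 1/8 and 1/8.
\<close>

subsection \<open>Fourier inversion\<close>

text \<open>\<open>fourier\<close> accepts real functions only. A complex version is needed because
  inversion is later applied to \<open>hilbert_fourier f\<close>, a complex-valued function on the
  frequency side.\<close>

definition complex_fourier :: "(real \<Rightarrow> complex) \<Rightarrow> real \<Rightarrow> complex" where
  "complex_fourier h \<xi> = (LINT x|lborel. h x * cis (- 2 * pi * x * \<xi>))"

lemma fourier_eq_complex_fourier: "fourier f = complex_fourier (\<lambda>x. complex_of_real (f x))"
  by (simp add: fourier_def complex_fourier_def fun_eq_iff)

lemma cis_borel_measurable [measurable]: "cis \<in> borel_measurable borel"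
  by (intro borel_measurable_continuous_onI continuous_intros)

lemma integrable_mult_cis:
  fixes h :: "real \<Rightarrow> complex"
  assumes "integrable lborel h" "u \<in> borel_measurable borel"
  shows "integrable lborel (\<lambda>x. h x * cis (u x))"
proof (rule Bochner_Integration.integrable_bound[OF assms(1)])
  show "(\<lambda>x. h x * cis (u x)) \<in> borel_measurable lborel"
    using assms by (auto intro!: borel_measurable_times measurable_compose[OF _ cis_borel_measurable])
qed (auto simp: norm_mult)

lemma continuous_complex_fourier:
  assumes h: "integrable lborel h"
  shows "continuous_on UNIV (complex_fourier h)"
proof -
  have "isCont (complex_fourier h) \<xi>" for \<xi>
    unfolding continuous_at_sequentially
  proof safe
    fix X :: "nat \<Rightarrow> real" assume X: "X \<longlonglongrightarrow> \<xi>"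
    show "(complex_fourier h \<circ> X) \<longlonglongrightarrow> complex_fourier h \<xi>"
      unfolding comp_def complex_fourier_def
    proof (rule integral_dominated_convergence[where w="\<lambda>x. norm (h x)"])
      show "AE x in lborel. (\<lambda>i. h x * cis (- 2 * pi * x * X i)) \<longlonglongrightarrow> h x * cis (- 2 * pi * x * \<xi>)"
        by (intro AE_I2 tendsto_intros X)
    qed (use h in \<open>auto simp: norm_mult intro!: borel_measurable_integrable integrable_mult_cis\<close>)
  qed
  then show ?thesis by (simp add: continuous_at_imp_continuous_on)
qed

lemma norm_complex_fourier_le:
  assumes "integrable lborel h"
  shows "norm (complex_fourier h \<xi>) \<le> (LINT x|lborel. norm (h x))"
proof -
  have "norm (complex_fourier h \<xi>) \<le> (LINT x|lborel. norm (h x * cis (- 2 * pi * x * \<xi>)))"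
    unfolding complex_fourier_def by (rule integral_norm_bound)
  then show ?thesis by (simp add: norm_mult)
qed

section \<open>Gaussian summability of the inverse Fourier integral\<close>

text \<open>This is the centred normal density with standard deviation
  \<open>1 / (2 * pi * n)\<close>: it has mass 1 and concentrates at 0 as \<open>n\<close>
  grows.\<close>

definition gauss_kernel :: "real \<Rightarrow> real \<Rightarrow> real" where
  "gauss_kernel n t = n * sqrt (2 * pi) * exp (- (2 * pi * n * t)\<^sup>2 / 2)"

lemma integrable_gauss:
  assumes "n > 0" shows "integrable lborel (\<lambda>\<xi>::real. exp (- (\<xi> / n)\<^sup>2 / 2))"
proof -
  have "integrable lborel std_normal_density" by simp
  from lborel_integrable_real_affine[OF this, of "1/n" 0] assms
  have "integrable lborel (\<lambda>x. sqrt (2*pi) * std_normal_density (x / n))" by simp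
  then show ?thesis
    by (simp add: std_normal_density_def)
qed

text \<open>The substitution \<open>\<xi> = n * x\<close> reduces the integral to the characteristic
  function of the standard normal law, which is again a Gaussian.\<close>

lemma gauss_fourier:
  assumes n: "n > 0"
  shows "(LINT \<xi>|lborel. complex_of_real (exp (- (\<xi> / n)\<^sup>2 / 2)) * cis (2 * pi * t * \<xi>)) =
    complex_of_real (gauss_kernel n t)"
proof -
  have "complex_of_real (exp (- (2 * pi * n * t)\<^sup>2 / 2)) = char std_normal_distribution (2 * pi * n * t)"
    by (simp add: char_std_normal_distribution)
  also have "\<dots> = (LINT x|lborel. std_normal_density x *\<^sub>R cis (2 * pi * n * t * x))"
    unfolding char_def
    by (subst integral_density) (auto simp: cis_conv_exp mult_ac)
  finally have *: "complex_of_real (exp (- (2 * pi * n * t)\<^sup>2 / 2)) =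
     (LINT x|lborel. std_normal_density x *\<^sub>R cis (2 * pi * n * t * x))" .
  have "(LINT \<xi>|lborel. complex_of_real (exp (- (\<xi> / n)\<^sup>2 / 2)) * cis (2 * pi * t * \<xi>)) =
    n *\<^sub>R (LINT x|lborel. sqrt (2 * pi) *\<^sub>R (std_normal_density x *\<^sub>R cis (2 * pi * n * t * x)))"
    using n by (subst lborel_integral_real_affine[where c=n and t=0])
      (auto simp: std_normal_density_def scaleR_conv_of_real mult_ac)
  also have "\<dots> = n *\<^sub>R sqrt (2 * pi) *\<^sub>R complex_of_real (exp (- (2 * pi * n * t)\<^sup>2 / 2))"
    unfolding * by (simp only: integral_scaleR_right)
  finally show ?thesis by (simp add: gauss_kernel_def scaleR_conv_of_real)
qed

text \<open>A crude tail estimate: only uniform decay in \<open>n\<close> away from 0 is wanted, to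
  make the far part of a Gaussian mean vanish in the limit.\<close>

lemma gauss_kernel_bound:
  assumes "n > 0" "\<bar>t\<bar> \<ge> 1"
  shows "\<bar>gauss_kernel n t\<bar> \<le> 1 / n"
proof -
  let ?a = "(2 * pi * n * t)\<^sup>2 / 2"
  have t2: "1 \<le> t\<^sup>2" using assms(2) by (metis abs_1 abs_le_square_iff one_power2)
  have "(2 * pi * n)\<^sup>2 / 2 * 1 \<le> (2 * pi * n)\<^sup>2 / 2 * t\<^sup>2" using t2 by (intro mult_left_mono) auto
  then have a: "2 * pi\<^sup>2 * n\<^sup>2 \<le> ?a" by (simp add: power_mult_distrib)
  have a0: "0 < 2 * pi\<^sup>2 * n\<^sup>2" using assms by simp
  \<comment> \<open>Trading the exponential for its argument leaves a factor of order
    \<open>1 / n\<^sup>2\<close>, which absorbs the prefactor \<open>n\<close> of the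
    kernel.\<close>
  have "?a \<le> exp ?a" using exp_ge_add_one_self[of ?a] by linarith
  then have "2 * pi\<^sup>2 * n\<^sup>2 \<le> exp ?a" using a by linarith
  then have e: "exp (- ?a) \<le> 1 / (2 * pi\<^sup>2 * n\<^sup>2)"
    unfolding exp_minus inverse_eq_divide using a0 by (intro divide_left_mono) auto
  have "sqrt (2 * pi) \<le> sqrt ((2 * pi)\<^sup>2)"
    using pi_gt3 by (intro real_sqrt_le_mono) (auto simp: power2_eq_square)
  then have s: "sqrt (2 * pi) \<le> 2 * pi" by (simp only: real_sqrt_abs) simp
  have "\<bar>gauss_kernel n t\<bar> = n * sqrt (2 * pi) * exp (- ?a)"
    using assms by (simp add: gauss_kernel_def abs_mult)
  also have "\<dots> \<le> n * (2 * pi) * (1 / (2 * pi\<^sup>2 * n\<^sup>2))"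
    using assms e s by (intro mult_mono) auto
  also have "\<dots> = 1 / (pi * n)" using assms by (simp add: power2_eq_square field_simps)
  also have "\<dots> \<le> 1 / n" using assms pi_gt3 by (intro divide_left_mono) auto
  finally show ?thesis .
qed

text \<open>Fubini: the Gaussian weight makes the double integrand absolutely integrable even when
  the transform of \<open>h\<close> is not integrable. The inner integral over \<open>\<xi>\<close>
  is then \<open>gauss_fourier\<close>.\<close>

lemma fourier_gauss_mean:
  fixes h :: "real \<Rightarrow> complex"
  assumes h: "integrable lborel h" and n: "n > 0"
  shows "(LINT \<xi>|lborel. complex_fourier h \<xi> * cis (2 * pi * x * \<xi>) * exp (- (\<xi> / n)\<^sup>2 / 2)) =
    (LINT y|lborel. h y * gauss_kernel n (x - y))"
proof -
  have [measurable]: "h \<in> borel_measurable borel" using borel_measurable_integrable[OF h] by simp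
  let ?F = "\<lambda>\<xi> y. h y * cis (2 * pi * (x - y) * \<xi>) * exp (- (\<xi> / n)\<^sup>2 / 2)"
  have 1: "integrable lborel (\<lambda>y. ?F \<xi> y)" for \<xi>
    by (intro integrable_mult_left integrable_mult_cis h) auto
  have int: "integrable (lborel \<Otimes>\<^sub>M lborel) (\<lambda>(\<xi>, y). ?F \<xi> y)"
  proof (rule lborel_pair.Fubini_integrable)
    have "integrable lborel (\<lambda>\<xi>. (LINT y|lborel. norm (h y)) * exp (- (\<xi> / n)\<^sup>2 / 2))"
      by (intro integrable_mult_right integrable_gauss n)
    then show "integrable lborel (\<lambda>\<xi>. LINT y|lborel. norm (case (\<xi>, y) of (\<xi>, y) \<Rightarrow> ?F \<xi> y))"
      by (simp add: norm_mult)
  qed (use 1 in auto)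
  have "(LINT \<xi>|lborel. complex_fourier h \<xi> * cis (2 * pi * x * \<xi>) * exp (- (\<xi> / n)\<^sup>2 / 2)) =
    (LINT \<xi>|lborel. LINT y|lborel. ?F \<xi> y)"
  proof (rule Bochner_Integration.integral_cong)
    fix \<xi> :: real
    have "complex_fourier h \<xi> * cis (2 * pi * x * \<xi>) * exp (- (\<xi> / n)\<^sup>2 / 2) =
      (LINT y|lborel. h y * cis (- 2 * pi * y * \<xi>) * (cis (2 * pi * x * \<xi>) * exp (- (\<xi> / n)\<^sup>2 / 2)))"
      by (simp add: complex_fourier_def)
    also have "\<dots> = (LINT y|lborel. ?F \<xi> y)"
      by (intro Bochner_Integration.integral_cong) (auto simp: mult.assoc cis_mult algebra_simps)
    finally show "complex_fourier h \<xi> * cis (2 * pi * x * \<xi>) * exp (- (\<xi> / n)\<^sup>2 / 2) = \<dots>" .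
  qed simp
  also have "\<dots> = (LINT y|lborel. LINT \<xi>|lborel. ?F \<xi> y)"
    using lborel_pair.Fubini_integral[OF int] by simp
  also have "\<dots> = (LINT y|lborel. h y * gauss_kernel n (x - y))"
  proof (rule Bochner_Integration.integral_cong)
    fix y
    have "(LINT \<xi>|lborel. ?F \<xi> y) =
      (LINT \<xi>|lborel. h y * (complex_of_real (exp (- (\<xi> / n)\<^sup>2 / 2)) * cis (2 * pi * (x - y) * \<xi>)))"
      by (intro Bochner_Integration.integral_cong) (auto simp: mult_ac)
    also have "\<dots> = h y * gauss_kernel n (x - y)"
      by (simp only: integral_mult_right_zero gauss_fourier[OF n])
    finally show "(LINT \<xi>|lborel. ?F \<xi> y) = h y * gauss_kernel n (x - y)" .
  qed simp
  finally show ?thesis .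
qed

text \<open>Approximate identity. Since \<open>h\<close> need not be bounded, it is split at
  distance 1 from \<open>x\<close>: the near part \<open>h1\<close> is bounded by compactness, so
  dominated convergence applies after rescaling; the far part \<open>h2\<close> is integrable and
  meets a kernel of size at most \<open>1 / n\<close>.\<close>

lemma gauss_mean_tendsto:
  fixes h :: "real \<Rightarrow> complex"
  assumes h: "integrable lborel h" and cont: "continuous_on UNIV h"
  shows "(\<lambda>n. LINT y|lborel. h y * gauss_kernel (real (Suc n)) (x - y)) \<longlonglongrightarrow> h x"
proof -
  have [measurable]: "h \<in> borel_measurable borel" using borel_measurable_integrable[OF h] by simp
  have [measurable]: "gauss_kernel n \<in> borel_measurable borel" for n
    unfolding gauss_kernel_def by measurable
  define B where "B = {x - 1..x + 1}"
  have [measurable]: "B \<in> sets borel" by (simp add: B_def)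
  define h1 where "h1 y = (if y \<in> B then h y else 0)" for y
  define h2 where "h2 y = (if y \<in> B then 0 else h y)" for y
  have [measurable]: "h1 \<in> borel_measurable borel" "h2 \<in> borel_measurable borel"
    unfolding h1_def h2_def by measurable
  have "compact (h ` B)" unfolding B_def
    by (intro compact_continuous_image continuous_on_subset[OF cont]) auto
  then obtain K where K: "\<And>y. y \<in> B \<Longrightarrow> norm (h y) \<le> K"
    by (meson bounded_iff compact_imp_bounded imageI)
  have K': "norm (h1 y) \<le> \<bar>K\<bar>" for y using K[of y] by (auto simp: h1_def)
  have gb: "\<bar>gauss_kernel n t\<bar> \<le> n * sqrt (2 * pi)" if "n > 0" for n t
    using that by (auto simp: gauss_kernel_def abs_mult intro!: mult_left_le)
  have int1: "integrable lborel (\<lambda>y. h1 y * gauss_kernel (real (Suc n)) (x - y))" for n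
    by (rule Bochner_Integration.integrable_bound
        [OF integrable_mult_left[OF integrable_norm[OF h], of "real (Suc n) * sqrt (2 * pi)"]])
      (use gb[of "real (Suc n)"] in
        \<open>auto simp: h1_def norm_mult simp del: of_nat_Suc intro!: AE_I2 mult_left_mono\<close>)
  have int2: "integrable lborel (\<lambda>y. h2 y * gauss_kernel (real (Suc n)) (x - y))" for n
    by (rule Bochner_Integration.integrable_bound
        [OF integrable_mult_left[OF integrable_norm[OF h], of "real (Suc n) * sqrt (2 * pi)"]])
      (use gb[of "real (Suc n)"] in
        \<open>auto simp: h2_def norm_mult simp del: of_nat_Suc intro!: AE_I2 mult_left_mono\<close>)
  have eq: "(LINT y|lborel. h y * gauss_kernel (real (Suc n)) (x - y)) =
     (LINT y|lborel. h1 y * gauss_kernel (real (Suc n)) (x - y)) +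
     (LINT y|lborel. h2 y * gauss_kernel (real (Suc n)) (x - y))" for n
    unfolding Bochner_Integration.integral_add[OF int1 int2, symmetric]
    by (intro Bochner_Integration.integral_cong) (auto simp: h1_def h2_def)
  have lim2: "(\<lambda>n. LINT y|lborel. h2 y * gauss_kernel (real (Suc n)) (x - y)) \<longlonglongrightarrow> 0"
  proof (rule Lim_null_comparison)
    show "(\<lambda>n. (LINT y|lborel. norm (h y)) * (1 / real (Suc n))) \<longlonglongrightarrow> 0"
      using tendsto_mult_right[OF LIMSEQ_inverse_real_of_nat, of "LINT y|lborel. norm (h y)"]
      by (simp add: inverse_eq_divide)
    show "\<forall>\<^sub>F n in sequentially. norm (LINT y|lborel. h2 y * gauss_kernel (real (Suc n)) (x - y))
       \<le> (LINT y|lborel. norm (h y)) * (1 / real (Suc n))"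
    proof (intro always_eventually allI)
      fix n
      have "norm (LINT y|lborel. h2 y * gauss_kernel (real (Suc n)) (x - y)) \<le>
        (LINT y|lborel. norm (h y) * (1 / real (Suc n)))"
      proof (rule Bochner_Integration.integral_norm_bound_integral)
        show "norm (h2 y * gauss_kernel (real (Suc n)) (x - y)) \<le> norm (h y) * (1 / real (Suc n))" for y
        proof (cases "y \<in> B")
          case False
          then have "\<bar>x - y\<bar> \<ge> 1" by (auto simp: B_def)
          then have "\<bar>gauss_kernel (real (Suc n)) (x - y)\<bar> \<le> 1 / real (Suc n)"
            by (intro gauss_kernel_bound) auto
          from mult_left_mono[OF this norm_ge_zero[of "h y"]] False show ?thesis
            by (simp add: h2_def norm_mult del: of_nat_Suc)
        qed (auto simp: h2_def)
        show "integrable lborel (\<lambda>y. norm (h y) * (1 / real (Suc n)))"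
          by (rule integrable_mult_left[OF integrable_norm[OF h]])
      qed (rule int2)
      then show "norm (LINT y|lborel. h2 y * gauss_kernel (real (Suc n)) (x - y))
       \<le> (LINT y|lborel. norm (h y)) * (1 / real (Suc n))" by simp
    qed
  qed
  \<comment> \<open>Rescaling \<open>y = x + u / (2 * pi * n)\<close> moves the dependence on
    \<open>n\<close> from the kernel into the argument of \<open>h1\<close>, leaving a fixed normal
    density.\<close>
  have sub: "(LINT y|lborel. h1 y * gauss_kernel (real (Suc n)) (x - y)) =
    (LINT u|lborel. h1 (x + u / (2 * pi * real (Suc n))) * std_normal_density u)" for n
  proof -
    let ?c = "1 / (2 * pi * real (Suc n))"
    have c: "?c > 0" by (simp del: of_nat_Suc)
    have *: "?c * gauss_kernel (real (Suc n)) (- (?c * u)) = std_normal_density u" for u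
    proof -
      have "2 * pi * real (Suc n) * - (?c * u) = - u" by (simp del: of_nat_Suc)
      then have "?c * gauss_kernel (real (Suc n)) (- (?c * u)) =
          sqrt (2 * pi) / (2 * pi) * exp (- u\<^sup>2 / 2)"
        unfolding gauss_kernel_def by (simp del: of_nat_Suc)
      also have "sqrt (2 * pi) / (2 * pi) = 1 / sqrt (2 * pi)"
        by (simp add: real_div_sqrt field_simps)
      finally show ?thesis by (simp add: std_normal_density_def)
    qed
    have "(LINT y|lborel. h1 y * gauss_kernel (real (Suc n)) (x - y)) =
      ?c *\<^sub>R (LINT u|lborel. h1 (x + ?c * u) * gauss_kernel (real (Suc n)) (- (?c * u)))"
      using c by (subst lborel_integral_real_affine[where c="?c" and t=x]) (auto simp del: of_nat_Suc)
    also have "\<dots> = (LINT u|lborel. h1 (x + ?c * u) * (?c * gauss_kernel (real (Suc n)) (- (?c * u))))"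
      by (subst integral_scaleR_right[symmetric])
        (auto simp: scaleR_conv_of_real mult_ac simp del: of_nat_Suc intro!: Bochner_Integration.integral_cong)
    finally show ?thesis unfolding * by simp
  qed
  have lim1: "(\<lambda>n. LINT u|lborel. h1 (x + u / (2 * pi * real (Suc n))) * std_normal_density u)
     \<longlonglongrightarrow> (LINT u|lborel. h x * std_normal_density u)"
  proof (rule integral_dominated_convergence[where w="\<lambda>u. \<bar>K\<bar> * std_normal_density u"])
    have "isCont h x" using cont by (simp add: continuous_on_eq_continuous_at)
    \<comment> \<open>The cut-off may create jumps at \<open>x - 1\<close> and \<open>x + 1\<close>,
      but near \<open>x\<close> it changes nothing, and only continuity at \<open>x\<close> enters
      the pointwise limit.\<close>
    have "isCont h1 x"
    proof -
      have "\<forall>\<^sub>F y in nhds x. h1 y = h y"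
        by (rule eventually_nhds_in_open[of "{x - 1<..<x + 1}", THEN eventually_mono]) (auto simp: h1_def B_def)
      then show ?thesis using \<open>isCont h x\<close> isCont_cong by blast
    qed
    show "AE u in lborel. (\<lambda>n. h1 (x + u / (2 * pi * real (Suc n))) * std_normal_density u)
       \<longlonglongrightarrow> h x * std_normal_density u"
    proof (intro AE_I2 tendsto_mult tendsto_const)
      fix u
      have "(\<lambda>n. x + u / (2 * pi) * inverse (real (Suc n))) \<longlonglongrightarrow> x + u / (2 * pi) * 0"
        by (intro tendsto_intros LIMSEQ_inverse_real_of_nat)
      then have "(\<lambda>n. x + u / (2 * pi * real (Suc n))) \<longlonglongrightarrow> x"
        by (simp add: field_simps)
      from isCont_tendsto_compose[OF \<open>isCont h1 x\<close> this]
      show "(\<lambda>n. h1 (x + u / (2 * pi * real (Suc n)))) \<longlonglongrightarrow> h x"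
        by (simp add: h1_def B_def)
    qed
    show "AE u in lborel. norm (h1 (x + u / (2 * pi * real (Suc n))) * std_normal_density u)
       \<le> \<bar>K\<bar> * std_normal_density u" for n
      using K' by (auto simp: norm_mult intro!: mult_right_mono)
    show "integrable lborel (\<lambda>u. \<bar>K\<bar> * std_normal_density u)" by simp
  qed measurable
  have "(LINT u|lborel. h x * std_normal_density u) = h x"
    by simp
  with lim1 have "(\<lambda>n. LINT y|lborel. h1 y * gauss_kernel (real (Suc n)) (x - y)) \<longlonglongrightarrow> h x"
    unfolding sub by simp
  from tendsto_add[OF this lim2] show ?thesis unfolding eq by simp
qed

text \<open>The Gaussian-weighted inverse integrals have two limits: the unweighted integral, by
  dominated convergence with majorant \<open>norm (complex_fourier h \<xi>)\<close>, and
  \<open>h x\<close>, by the approximate identity. Continuity of \<open>h\<close> makes the identity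
  hold at every point.\<close>

lemma fourier_inversion:
  fixes h :: "real \<Rightarrow> complex"
  assumes h: "integrable lborel h" and cont: "continuous_on UNIV h"
    and hh: "integrable lborel (complex_fourier h)"
  shows "h x = (LINT \<xi>|lborel. complex_fourier h \<xi> * cis (2 * pi * x * \<xi>))"
proof -
  have [measurable]: "complex_fourier h \<in> borel_measurable borel"
    using borel_measurable_integrable[OF hh] by simp
  have "(\<lambda>n. LINT \<xi>|lborel. complex_fourier h \<xi> * cis (2 * pi * x * \<xi>) * exp (- (\<xi> / real (Suc n))\<^sup>2 / 2))
     \<longlonglongrightarrow> (LINT \<xi>|lborel. complex_fourier h \<xi> * cis (2 * pi * x * \<xi>))"
  proof (rule integral_dominated_convergence[where w="\<lambda>\<xi>. norm (complex_fourier h \<xi>)"])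
    show "AE \<xi> in lborel. (\<lambda>n. complex_fourier h \<xi> * cis (2 * pi * x * \<xi>) * exp (- (\<xi> / real (Suc n))\<^sup>2 / 2))
       \<longlonglongrightarrow> complex_fourier h \<xi> * cis (2 * pi * x * \<xi>)"
    proof (intro AE_I2)
      fix \<xi>
      have "(\<lambda>n. complex_fourier h \<xi> * cis (2 * pi * x * \<xi>) * exp (- (\<xi> * inverse (real (Suc n)))\<^sup>2 / 2))
         \<longlonglongrightarrow> complex_fourier h \<xi> * cis (2 * pi * x * \<xi>) * exp (- (\<xi> * 0)\<^sup>2 / 2)"
        by (intro tendsto_intros LIMSEQ_inverse_real_of_nat) auto
      then show "(\<lambda>n. complex_fourier h \<xi> * cis (2 * pi * x * \<xi>) * exp (- (\<xi> / real (Suc n))\<^sup>2 / 2))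
         \<longlonglongrightarrow> complex_fourier h \<xi> * cis (2 * pi * x * \<xi>)"
        by (simp add: field_simps)
    qed
    show "AE \<xi> in lborel. norm (complex_fourier h \<xi> * cis (2 * pi * x * \<xi>) * exp (- (\<xi> / real (Suc n))\<^sup>2 / 2))
       \<le> norm (complex_fourier h \<xi>)" for n
      by (auto simp: norm_mult intro!: mult_left_le)
    show "integrable lborel (\<lambda>\<xi>. norm (complex_fourier h \<xi>))"
      using hh by simp
  qed measurable
  then have "(\<lambda>n. LINT y|lborel. h y * gauss_kernel (real (Suc n)) (x - y))
     \<longlonglongrightarrow> (LINT \<xi>|lborel. complex_fourier h \<xi> * cis (2 * pi * x * \<xi>))"
    by (subst (asm) fourier_gauss_mean[OF h]) auto
  with gauss_mean_tendsto[OF h cont] show ?thesis by (rule LIMSEQ_unique)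
qed

subsection \<open>The Hilbert transform as a Fourier multiplier\<close>

text \<open>The multiplier side of the Hilbert transform, kept separate from
  \<open>fourier (hilbert f)\<close> because \<open>hilbert\<close> is defined by a principal value;
  \<open>fourier_hilbert\<close> identifies the two.\<close>

definition hilbert_fourier :: "(real \<Rightarrow> real) \<Rightarrow> real \<Rightarrow> complex" where
  "hilbert_fourier f \<xi> = - \<i> * of_real (sgn \<xi>) * fourier f \<xi>"

text \<open>Reflecting the negative half-line and using that \<open>1 / y\<close> is odd gives a
  symmetric difference, where the singularity at 0 can cancel. The two halves may be treated
  separately because \<open>1 / \<bar>y\<bar>\<close> is below \<open>1 / \<epsilon>\<close> on
  them.\<close>

lemma hilbert_truncation:
  fixes f :: "real \<Rightarrow> real"
  assumes f: "integrable lborel f" and \<epsilon>: "\<epsilon> > 0"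
  shows "(LINT y:{y. \<epsilon> < \<bar>y\<bar>}|lborel. f (x - y) / y) =
    (LINT y|lborel. indicator {\<epsilon><..} y * ((f (x - y) - f (x + y)) / y))"
proof -
  have [measurable]: "f \<in> borel_measurable borel" using borel_measurable_integrable[OF f] by simp
  have fm: "integrable lborel (\<lambda>y. f (x - y))" and fp: "integrable lborel (\<lambda>y. f (x + y))"
    using lborel_integrable_real_affine[OF f, of "-1" x] lborel_integrable_real_affine[OF f, of 1 x]
    by auto
  have bd: "\<bar>indicator S y * (a / y)\<bar> \<le> \<bar>a\<bar> / \<epsilon>" if "y \<in> S \<Longrightarrow> \<epsilon> < \<bar>y\<bar>" for S y a
    using that \<epsilon> by (auto simp: indicator_def abs_mult intro!: divide_left_mono)
  have i: "integrable lborel (\<lambda>y. indicator S y * (g y / y))"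
    if g: "integrable lborel g" and S: "\<And>y. y \<in> S \<Longrightarrow> \<epsilon> < \<bar>y\<bar>" and [measurable]: "S \<in> sets borel" for g S
  proof -
    have [measurable]: "g \<in> borel_measurable borel" using borel_measurable_integrable[OF g] by simp
    show ?thesis
      by (rule Bochner_Integration.integrable_bound[OF integrable_divide[OF integrable_norm[OF g], of \<epsilon>]])
        (use \<epsilon> bd[OF S] in \<open>auto intro!: AE_I2\<close>)
  qed
  have "(LINT y:{y. \<epsilon> < \<bar>y\<bar>}|lborel. f (x - y) / y) =
    (LINT y|lborel. indicator {\<epsilon><..} y * (f (x - y) / y) + indicator {..<-\<epsilon>} y * (f (x - y) / y))"
    unfolding set_lebesgue_integral_def
    by (intro Bochner_Integration.integral_cong) (use \<epsilon> in \<open>auto simp: indicator_def\<close>)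
  also have "\<dots> = (LINT y|lborel. indicator {\<epsilon><..} y * (f (x - y) / y)) +
      (LINT y|lborel. indicator {..<-\<epsilon>} y * (f (x - y) / y))"
    by (intro Bochner_Integration.integral_add i fm) auto
  also have "(LINT y|lborel. indicator {..<-\<epsilon>} y * (f (x - y) / y)) =
      (LINT y|lborel. - (indicator {\<epsilon><..} y * (f (x + y) / y)))"
    by (subst lborel_integral_real_affine[where c="-1" and t=0])
      (auto simp: indicator_def intro!: Bochner_Integration.integral_cong)
  also have "(LINT y|lborel. indicator {\<epsilon><..} y * (f (x - y) / y)) + \<dots> =
     (LINT y|lborel. indicator {\<epsilon><..} y * (f (x - y) / y) + - (indicator {\<epsilon><..} y * (f (x + y) / y)))"
    by (intro Bochner_Integration.integral_add[symmetric] i fm Bochner_Integration.integrable_minus fp) auto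
  finally show ?thesis by (simp add: algebra_simps diff_divide_distrib)
qed

text \<open>The case \<open>y = 0\<close> is covered because division by zero yields 0.\<close>

lemma abs_sin_divide_le: "\<bar>sin (a * y) / y\<bar> \<le> \<bar>a\<bar>" for a y :: real
  using abs_sin_x_le_abs_x[of "a * y"] by (cases "y = 0") (auto simp: abs_mult field_simps)

text \<open>The factor \<open>sgn a\<close> is where the sign in the Hilbert multiplier comes
  from.\<close>

lemma sin_integral_Si:
  assumes "N \<ge> 0"
  shows "(LINT y|lborel. indicator {0<..<N} y * (sin (a * y) / y)) = sgn a * Si (N * \<bar>a\<bar>)"
  using LBINT_I0c_sin_scale_divide[OF assms, of a] assms
  by (simp add: interval_lebesgue_integral_def set_lebesgue_integral_def zero_ereal_def mult.commute)

text \<open>Inversion writes the symmetric difference quotient as a superposition of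
  \<open>sin (2 * pi * \<xi> * y) / y\<close>. Integrating over \<open>y\<close> in
  \<open>(0, n)\<close>, exchanging the integrals and letting \<open>n\<close> grow turns each sine
  integral into \<open>sgn \<xi> * (pi / 2)\<close>.\<close>

lemma hilbert_eq_inverse_fourier:
  assumes f: "integrable lborel f" and cont: "continuous_on UNIV f"
    and supp: "\<And>\<xi>. \<bar>\<xi>\<bar> > 1 \<Longrightarrow> fourier f \<xi> = 0"
    and F: "integrable lborel (fourier f)"
  shows "complex_of_real (hilbert f x) = (LINT \<xi>|lborel. hilbert_fourier f \<xi> * cis (2 * pi * x * \<xi>))"
proof -
  have [measurable]: "f \<in> borel_measurable borel" "fourier f \<in> borel_measurable borel"
    using borel_measurable_integrable[OF f] borel_measurable_integrable[OF F] by simp_all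
  define D where "D y = (f (x - y) - f (x + y)) / y" for y
  have [measurable]: "D \<in> borel_measurable borel" unfolding D_def by measurable
  \<comment> \<open>The factor \<open>- 2 * \<i>\<close> comes from
    \<open>cis (- a) - cis a = - 2 * \<i> * sin a\<close>.\<close>
  define E where "E \<xi> = - 2 * \<i> * (fourier f \<xi> * cis (2 * pi * x * \<xi>))" for \<xi>
  have [measurable]: "E \<in> borel_measurable borel" unfolding E_def by measurable
  have E: "integrable lborel E"
    unfolding E_def by (intro integrable_mult_right integrable_mult_cis F) auto
  have Esupp: "E \<xi> = 0" if "\<bar>\<xi>\<bar> > 1" for \<xi> using supp[OF that] by (simp add: E_def)
  \<comment> \<open>The band limit enters here: \<open>E\<close> vanishes for
    \<open>\<bar>\<xi>\<bar> > 1\<close>, so the kernel costs at most \<open>2 * pi\<close>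
    uniformly in \<open>y\<close>. This bounds \<open>D\<close> near 0 without assuming
    \<open>f\<close> differentiable.\<close>
  have normE: "norm (E \<xi> * (sin (2 * pi * \<xi> * y) / y)) \<le> 2 * pi * norm (E \<xi>)" for \<xi> y
  proof (cases "\<bar>\<xi>\<bar> > 1")
    case False
    have "\<bar>sin (2 * pi * \<xi> * y) / y\<bar> \<le> \<bar>2 * pi * \<xi>\<bar>" by (rule abs_sin_divide_le)
    also have "\<dots> \<le> 2 * pi * 1" using False by (auto simp: abs_mult)
    finally show ?thesis unfolding norm_mult norm_of_real
      by (metis mult.commute mult_left_mono norm_ge_zero mult.right_neutral)
  qed (simp add: Esupp)
  have inv: "complex_of_real (f t) = (LINT \<xi>|lborel. fourier f \<xi> * cis (2 * pi * t * \<xi>))" for t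
    unfolding fourier_eq_complex_fourier
    by (rule fourier_inversion) (use f F cont in
      \<open>auto simp flip: fourier_eq_complex_fourier intro!: continuous_intros\<close>)
  have D: "complex_of_real (D y) = (LINT \<xi>|lborel. E \<xi> * (sin (2 * pi * \<xi> * y) / y))" for y
  proof -
    have "complex_of_real (D y) = (LINT \<xi>|lborel. (fourier f \<xi> * cis (2 * pi * (x - y) * \<xi>) -
        fourier f \<xi> * cis (2 * pi * (x + y) * \<xi>)) / y)"
      unfolding D_def
      by (simp add: inv Bochner_Integration.integral_diff integrable_mult_cis F)
    also have "\<dots> = (LINT \<xi>|lborel. E \<xi> * (sin (2 * pi * \<xi> * y) / y))"
    proof (intro Bochner_Integration.integral_cong refl)
      fix \<xi>
      have "cis (2 * pi * (x - y) * \<xi>) - cis (2 * pi * (x + y) * \<xi>) =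
         cis (2 * pi * x * \<xi>) * (cis (- (2 * pi * \<xi> * y)) - cis (2 * pi * \<xi> * y))"
        by (simp only: right_diff_distrib cis_mult) (simp add: algebra_simps)
      also have "cis (- (2 * pi * \<xi> * y)) - cis (2 * pi * \<xi> * y) = - 2 * \<i> * sin (2 * pi * \<xi> * y)"
        by (simp add: complex_eq_iff)
      finally have eq: "cis (2 * pi * (x - y) * \<xi>) - cis (2 * pi * (x + y) * \<xi>) =
         cis (2 * pi * x * \<xi>) * (- 2 * \<i> * sin (2 * pi * \<xi> * y))" .
      show "(fourier f \<xi> * cis (2 * pi * (x - y) * \<xi>) -
        fourier f \<xi> * cis (2 * pi * (x + y) * \<xi>)) / y = E \<xi> * (sin (2 * pi * \<xi> * y) / y)"
        unfolding right_diff_distrib[symmetric] eq E_def by (simp add: mult_ac)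
    qed
    finally show ?thesis .
  qed
  define M where "M = (LINT \<xi>|lborel. 2 * pi * norm (E \<xi>))"
  have M: "\<bar>D y\<bar> \<le> M" for y
  proof -
    have "norm (LINT \<xi>|lborel. E \<xi> * (sin (2 * pi * \<xi> * y) / y)) \<le> M"
      unfolding M_def
    proof (rule Bochner_Integration.integral_norm_bound_integral)
      show i: "integrable lborel (\<lambda>\<xi>. 2 * pi * norm (E \<xi>))"
        by (intro integrable_mult_right integrable_norm E)
      show "integrable lborel (\<lambda>\<xi>. E \<xi> * (sin (2 * pi * \<xi> * y) / y))"
        by (rule Bochner_Integration.integrable_bound[OF i]) (use normE in \<open>auto intro!: AE_I2\<close>)
    qed (rule normE)
    then show ?thesis unfolding D[symmetric] by simp
  qed
  have M0: "M \<ge> 0" using M[of 0] by linarith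
  \<comment> \<open>One majorant for both the limit at 0 and the limit at infinity: the constant
    \<open>M\<close> up to 1, and beyond it two translates of \<open>\<bar>f\<bar>\<close>, where
    \<open>1 / y\<close> is at most 1.\<close>
  define w where "w y = M * indicator {0..1} y + (\<bar>f (x - y)\<bar> + \<bar>f (x + y)\<bar>)" for y
  have w: "integrable lborel w"
    unfolding w_def
    using lborel_integrable_real_affine[OF f, of "-1" x] lborel_integrable_real_affine[OF f, of 1 x]
    by (intro Bochner_Integration.integrable_add integrable_mult_right integrable_abs) auto
  have Dw: "norm (indicator S y * D y) \<le> w y" if S: "S \<subseteq> {0<..}" for S y
  proof (cases "y \<in> S")
    case True
    then have y: "y > 0" using S by auto
    show ?thesis
    proof (cases "y \<le> 1")
      case le: True
      then show ?thesis using M[of y] True y by (auto simp: w_def)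
    next
      case False
      then have "\<bar>D y\<bar> \<le> \<bar>f (x - y) - f (x + y)\<bar>"
        using mult_right_mono[of 1 y "\<bar>f (x - y) - f (x + y)\<bar>"] by (simp add: D_def field_simps)
      then show ?thesis using True False by (auto simp: w_def)
    qed
  qed (use M0 in \<open>auto simp: w_def\<close>)
  let ?I = "LINT y|lborel. indicator {0<..} y * D y"
  have H: "hilbert f x = ?I / pi"
  proof -
    have "((\<lambda>\<epsilon>. LINT y|lborel. indicator {\<epsilon><..} y * D y) \<longlongrightarrow> ?I) (at_right 0)"
    \<comment> \<open>Passing to sequences makes dominated convergence applicable; the upper end 1
      is arbitrary.\<close>
    proof (rule tendsto_at_right_sequentially[of 0 1])
      fix S :: "nat \<Rightarrow> real" assume S: "\<And>n. 0 < S n" "S \<longlonglongrightarrow> 0"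
      show "(\<lambda>n. LINT y|lborel. indicator {S n<..} y * D y) \<longlonglongrightarrow> ?I"
      proof (rule integral_dominated_convergence[where w=w])
        show "AE y in lborel. (\<lambda>n. indicator {S n<..} y * D y) \<longlonglongrightarrow> indicator {0<..} y * D y"
        proof (intro AE_I2 tendsto_mult tendsto_const)
          fix y :: real
          show "(\<lambda>n. indicator {S n<..} y :: real) \<longlonglongrightarrow> indicator {0<..} y"
          proof (cases "y > 0")
            case True
            have "\<forall>\<^sub>F n in sequentially. S n < y" using S(2) True by (rule order_tendstoD)
            then show ?thesis
              by (rule tendsto_eventually[OF eventually_mono]) (use True in auto)
          next
            case False
            then have "\<not> S n < y" for n using S(1)[of n] by auto
            then show ?thesis using False by simp
          qed
        qed
        have "{S n<..} \<subseteq> {0<..}" for n using S(1)[of n] by auto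
        from Dw[OF this] show "AE y in lborel. norm (indicator {S n<..} y * D y) \<le> w y" for n by simp
      qed (use w in auto)
    qed simp
    then have "((\<lambda>\<epsilon>. 1 / pi * (LINT y|lborel. indicator {\<epsilon><..} y * D y)) \<longlongrightarrow> 1 / pi * ?I) (at_right 0)"
      by (intro tendsto_intros)
    moreover have "\<forall>\<^sub>F \<epsilon> in at_right 0. 1 / pi * (LINT y|lborel. indicator {\<epsilon><..} y * D y) =
       1 / pi * (LINT y:{y. \<epsilon> < \<bar>y\<bar>}|lborel. f (x - y) / y)"
      using eventually_at_right_less[of 0]
      by eventually_elim (simp add: hilbert_truncation[OF f] D_def)
    ultimately have "((\<lambda>\<epsilon>. 1 / pi * (LINT y:{y. \<epsilon> < \<bar>y\<bar>}|lborel. f (x - y) / y)) \<longlongrightarrow> 1 / pi * ?I) (at_right 0)"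
      by (rule Lim_transform_eventually)
    \<comment> \<open>\<open>Lim\<close> is a definite description, so its value can be read off
      only once convergence is established.\<close>
    then show ?thesis unfolding hilbert_def by (subst tendsto_Lim) auto
  qed
  have lim_I: "(\<lambda>n. LINT y|lborel. indicator {0<..<real n} y * D y) \<longlonglongrightarrow> ?I"
  proof (rule integral_dominated_convergence[where w=w])
    show "AE y in lborel. (\<lambda>n. indicator {0<..<real n} y * D y) \<longlonglongrightarrow> indicator {0<..} y * D y"
    proof (intro AE_I2 tendsto_mult tendsto_const tendsto_eventually)
      fix y :: real
      obtain m :: nat where "y < real m" using reals_Archimedean2 by blast
      then show "\<forall>\<^sub>F n in sequentially. (indicator {0<..<real n} y :: real) = indicator {0<..} y"
        by (intro eventually_sequentiallyI[of m]) (auto simp: indicator_def)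
    qed
    show "AE y in lborel. norm (indicator {0<..<real n} y * D y) \<le> w y" for n
      by (intro AE_I2 Dw) auto
  qed (use w in auto)
  \<comment> \<open>The cut at \<open>n\<close> is what permits Fubini:
    \<open>sin (a * y) / y\<close> is not absolutely integrable on the whole half-line for nonzero
    \<open>a\<close>.\<close>
  have Fub: "complex_of_real (LINT y|lborel. indicator {0<..<real n} y * D y) =
    (LINT \<xi>|lborel. E \<xi> * (sgn (2 * pi * \<xi>) * Si (real n * \<bar>2 * pi * \<xi>\<bar>)))" for n
  proof -
    let ?G = "\<lambda>y \<xi>. E \<xi> * (indicator {0<..<real n} y * (sin (2 * pi * \<xi> * y) / y))"
    have int: "integrable (lborel \<Otimes>\<^sub>M lborel) (\<lambda>(y, \<xi>). ?G y \<xi>)"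
    proof (rule Bochner_Integration.integrable_bound)
      show "integrable (lborel \<Otimes>\<^sub>M lborel) (\<lambda>(y, \<xi>). indicator {0<..<real n} y * (2 * pi * norm (E \<xi>)))"
      proof (rule lborel_pair.Fubini_integrable)
        show "integrable lborel (\<lambda>y. LINT \<xi>|lborel. norm (case (y, \<xi>) of (y, \<xi>) \<Rightarrow>
           indicator {0<..<real n} y * (2 * pi * norm (E \<xi>))))"
          by (simp add: abs_mult)
        show "AE y in lborel. integrable lborel (\<lambda>\<xi>. case (y, \<xi>) of (y, \<xi>) \<Rightarrow>
           indicator {0<..<real n} y * (2 * pi * norm (E \<xi>)))"
          using E by simp
      qed measurable
      show "AE z in lborel \<Otimes>\<^sub>M lborel. norm (case z of (y, \<xi>) \<Rightarrow> ?G y \<xi>) \<le>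
        norm (case z of (y, \<xi>) \<Rightarrow> indicator {0<..<real n} y * (2 * pi * norm (E \<xi>)))"
        using normE by (intro AE_I2) (auto simp: indicator_def)
    qed measurable
    have "complex_of_real (LINT y|lborel. indicator {0<..<real n} y * D y) =
      (LINT y|lborel. complex_of_real (indicator {0<..<real n} y * D y))"
      by (simp only: integral_complex_of_real)
    also have "\<dots> = (LINT y|lborel. LINT \<xi>|lborel. ?G y \<xi>)"
    proof (intro Bochner_Integration.integral_cong refl)
      fix y
      show "complex_of_real (indicator {0<..<real n} y * D y) = (LINT \<xi>|lborel. ?G y \<xi>)"
        using D[of y] by (cases "y \<in> {0<..<real n}") auto
    qed
    also have "\<dots> = (LINT \<xi>|lborel. LINT y|lborel. ?G y \<xi>)"
      using lborel_pair.Fubini_integral[OF int] by simp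
    also have "\<dots> = (LINT \<xi>|lborel. E \<xi> * (LINT y|lborel. indicator {0<..<real n} y * (sin (2 * pi * \<xi> * y) / y)))"
      by (simp only: integral_mult_right_zero integral_complex_of_real)
    finally show ?thesis by (simp only: sin_integral_Si of_nat_0_le_iff)
  qed
  obtain C where C: "\<And>T. \<bar>Si T\<bar> \<le> C" using bounded_Si by blast
  \<comment> \<open>\<open>Si\<close> tends to \<open>pi / 2\<close> at infinity, and its uniform
    bound \<open>C\<close> supplies the majorant. At \<open>\<xi> = 0\<close> both sides vanish,
    since \<open>sgn 0 = 0\<close>.\<close>
  have lim_E: "(\<lambda>n. LINT \<xi>|lborel. E \<xi> * (sgn (2 * pi * \<xi>) * Si (real n * \<bar>2 * pi * \<xi>\<bar>))) \<longlonglongrightarrow>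
    (LINT \<xi>|lborel. E \<xi> * (sgn \<xi> * (pi / 2)))"
  proof (rule integral_dominated_convergence[where w="\<lambda>\<xi>. norm (E \<xi>) * C"])
    show "AE \<xi> in lborel. (\<lambda>n. E \<xi> * (sgn (2 * pi * \<xi>) * Si (real n * \<bar>2 * pi * \<xi>\<bar>))) \<longlonglongrightarrow>
       E \<xi> * (sgn \<xi> * (pi / 2))"
    proof (intro AE_I2 tendsto_mult[OF tendsto_const tendsto_of_real])
      fix \<xi> :: real
      show "(\<lambda>n. sgn (2 * pi * \<xi>) * Si (real n * \<bar>2 * pi * \<xi>\<bar>)) \<longlonglongrightarrow> sgn \<xi> * (pi / 2)"
      proof (cases "\<xi> = 0")
        case False
        have "filterlim (\<lambda>n. real n * \<bar>2 * pi * \<xi>\<bar>) at_top sequentially"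
          by (rule filterlim_at_top_mult_tendsto_pos[OF tendsto_const _ filterlim_real_sequentially])
            (use False in auto)
        from filterlim_compose[OF Si_at_top this] show ?thesis
          by (intro tendsto_mult) (auto simp: sgn_mult)
      qed simp
    qed
    show "AE \<xi> in lborel. norm (E \<xi> * (sgn (2 * pi * \<xi>) * Si (real n * \<bar>2 * pi * \<xi>\<bar>))) \<le> norm (E \<xi>) * C" for n
    proof (intro AE_I2)
      fix \<xi> :: real
      have "\<bar>sgn (2 * pi * \<xi>) * Si (real n * \<bar>2 * pi * \<xi>\<bar>)\<bar> \<le> 1 * C"
        unfolding abs_mult by (intro mult_mono C) (auto simp: abs_sgn_eq)
      then show "norm (E \<xi> * (sgn (2 * pi * \<xi>) * Si (real n * \<bar>2 * pi * \<xi>\<bar>))) \<le> norm (E \<xi>) * C"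
        unfolding norm_mult norm_of_real by (intro mult_left_mono) (auto simp: abs_mult)
    qed
    show "integrable lborel (\<lambda>\<xi>. norm (E \<xi>) * C)"
      by (intro integrable_mult_left integrable_norm E)
  qed measurable
  have "(\<lambda>n. LINT \<xi>|lborel. E \<xi> * (sgn (2 * pi * \<xi>) * Si (real n * \<bar>2 * pi * \<xi>\<bar>)))
     \<longlonglongrightarrow> complex_of_real ?I"
    unfolding Fub[symmetric] by (intro tendsto_of_real lim_I)
  from LIMSEQ_unique[OF this lim_E] have "complex_of_real ?I = (LINT \<xi>|lborel. E \<xi> * (sgn \<xi> * (pi / 2)))" .
  \<comment> \<open>The product of \<open>- 2 * \<i>\<close> and \<open>pi / 2\<close> is
    \<open>- \<i> * pi\<close>; this \<open>pi\<close> cancels the normalisation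
    \<open>1 / pi\<close> of \<open>hilbert\<close>.\<close>
  also have "\<dots> = (LINT \<xi>|lborel. pi * (hilbert_fourier f \<xi> * cis (2 * pi * x * \<xi>)))"
    by (intro Bochner_Integration.integral_cong) (auto simp: E_def hilbert_fourier_def mult_ac)
  finally show ?thesis unfolding H by simp
qed

subsection \<open>Lower bounds for the sign radii\<close>

text \<open>Mean zero forces the negative part of \<open>g\<close> to carry half of the L1 norm, yet
  that part lives on an interval of length \<open>2 * r\<close> and is bounded by a multiple of the
  same norm.\<close>

lemma sign_radius_ge:
  fixes g :: "real \<Rightarrow> real"
  assumes g: "integrable lborel g" and mean: "(LINT x|lborel. g x) = 0"
    and bound: "\<And>x. \<bar>g x\<bar> \<le> 2 * (LINT x|lborel. \<bar>g x\<bar>)"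
    and nz: "(LINT x|lborel. \<bar>g x\<bar>) \<noteq> 0"
    and r: "r > 0" and sign: "\<And>x. \<bar>x\<bar> \<ge> r \<Longrightarrow> g x \<ge> 0"
  shows "r \<ge> 1 / 8"
proof -
  let ?N = "LINT x|lborel. \<bar>g x\<bar>"
  have N: "?N > 0" using nz by (simp add: order.strict_iff_order)
  have "?N = (LINT x|lborel. \<bar>g x\<bar> - g x)"
    using g mean by simp
  also have "\<dots> \<le> (LINT x|lborel. 4 * ?N * indicator {-r..r} x)"
  proof (rule integral_mono)
    \<comment> \<open>The difference is at most \<open>2 * \<bar>g x\<bar>\<close>, and
      \<open>bound\<close> doubles this again, hence the 4.\<close>
    show "\<bar>g x\<bar> - g x \<le> 4 * ?N * indicator {-r..r} x" for x
    proof (cases "x \<in> {-r..r}")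
      case False
      then have "g x \<ge> 0" by (intro sign) auto
      with False show ?thesis by simp
    qed (use bound[of x] in auto)
    show "integrable lborel (\<lambda>x. 4 * ?N * indicator {-r..r} x)"
      by (intro integrable_mult_right integrable_real_indicator) (use r in auto)
  qed (use g in auto)
  also have "\<dots> = 8 * r * ?N" using r by simp
  finally have "1 * ?N \<le> 8 * r * ?N" by simp
  then have "1 \<le> 8 * r" using N by (rule mult_right_le_imp_le)
  then show ?thesis by simp
qed

text \<open>The transform is bounded by the L1 norm and lives on \<open>[-1, 1]\<close>, whose
  length is the factor 2. Inversion is a hypothesis so that the lemma serves \<open>f\<close> and
  \<open>hilbert f\<close> alike, which obtain it in different ways.\<close>

lemma bandlimited_sup_bound:
  assumes g: "integrable lborel g"
    and supp: "\<And>\<xi>. \<bar>\<xi>\<bar> > 1 \<Longrightarrow> fourier g \<xi> = 0"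
    and inv: "complex_of_real (g x) = (LINT \<xi>|lborel. fourier g \<xi> * cis (2 * pi * x * \<xi>))"
    and F: "integrable lborel (fourier g)"
  shows "\<bar>g x\<bar> \<le> 2 * (LINT x|lborel. \<bar>g x\<bar>)"
proof -
  let ?N = "LINT x|lborel. \<bar>g x\<bar>"
  have "norm (LINT \<xi>|lborel. fourier g \<xi> * cis (2 * pi * x * \<xi>)) \<le> (LINT \<xi>|lborel. ?N * indicator {-1..1::real} \<xi>)"
  proof (rule Bochner_Integration.integral_norm_bound_integral)
    show "norm (fourier g \<xi> * cis (2 * pi * x * \<xi>)) \<le> ?N * indicator {-1..1::real} \<xi>" for \<xi>
    proof (cases "\<bar>\<xi>\<bar> > 1")
      case False
      then have "\<xi> \<in> {-1..1}" by auto
      moreover have "norm (fourier g \<xi>) \<le> ?N"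
        using norm_complex_fourier_le[of "\<lambda>x. complex_of_real (g x)" \<xi>] g
        by (simp add: fourier_eq_complex_fourier)
      ultimately show ?thesis by (simp add: norm_mult)
    qed (simp add: supp)
  qed (use F in \<open>auto intro!: integrable_mult_cis\<close>)
  also have "\<dots> = 2 * ?N" by simp
  finally show ?thesis unfolding inv[symmetric] by simp
qed

section \<open>Functions in \<open>PW1\<close> and their Hilbert transforms\<close>

text \<open>The transform is integrable because it is continuous and vanishes outside a compact
  interval.\<close>

lemma PW1_D:
  assumes "f \<in> PW1"
  shows "continuous_on UNIV f" "integrable lborel f" "\<And>\<xi>. \<bar>\<xi>\<bar> > 1 \<Longrightarrow> fourier f \<xi> = 0"
    "continuous_on UNIV (fourier f)" "integrable lborel (fourier f)"
proof -
  show f: "continuous_on UNIV f" "integrable lborel f" using assms by (auto simp: PW1_def)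
  have "{\<xi>. fourier f \<xi> \<noteq> 0} \<subseteq> {-1..1}"
    using assms closure_subset[of "{\<xi>. fourier f \<xi> \<noteq> 0}"] by (auto simp: PW1_def)
  then show supp: "fourier f \<xi> = 0" if "\<bar>\<xi>\<bar> > 1" for \<xi> using that by force
  show cont: "continuous_on UNIV (fourier f)"
    unfolding fourier_eq_complex_fourier using f by (intro continuous_complex_fourier) auto
  have "set_integrable lborel {-1..1} (fourier f)"
    by (rule borel_integrable_atLeastAtMost') (rule continuous_on_subset[OF cont], auto)
  moreover have "indicator {-1..1} \<xi> *\<^sub>R fourier f \<xi> = fourier f \<xi>" for \<xi>
    using supp[of \<xi>] by (cases "\<xi> \<in> {-1..1}") auto
  ultimately show "integrable lborel (fourier f)" by (simp add: set_integrable_def)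
qed

lemma PW1_inversion:
  assumes "f \<in> PW1"
  shows "complex_of_real (f x) = (LINT \<xi>|lborel. fourier f \<xi> * cis (2 * pi * x * \<xi>))"
  unfolding fourier_eq_complex_fourier
  by (rule fourier_inversion) (use PW1_D[OF assms] in
    \<open>auto simp flip: fourier_eq_complex_fourier intro!: continuous_intros\<close>)

lemma PW1_hilbert:
  assumes "f \<in> PW1"
  shows "complex_of_real (hilbert f x) = (LINT \<xi>|lborel. hilbert_fourier f \<xi> * cis (2 * pi * x * \<xi>))"
  by (rule hilbert_eq_inverse_fourier) (use PW1_D[OF assms] in auto)

lemma fourier_zero_eq_mean: "fourier g 0 = complex_of_real (LINT x|lborel. g x)"
  by (simp add: fourier_def)

text \<open>Lets a nonzero transform certify a nonzero L1 norm, with no argument about functions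
  vanishing almost everywhere.\<close>

lemma fourier_eq_0_if_norm_0:
  assumes "integrable lborel g" "(LINT x|lborel. \<bar>g x\<bar>) = 0"
  shows "fourier g \<xi> = 0"
  using norm_complex_fourier_le[of "\<lambda>x. complex_of_real (g x)" \<xi>] assms
  by (simp add: fourier_eq_complex_fourier)

lemma PW1_fourier_nonzero:
  assumes "f \<in> PW1" "f \<noteq> (\<lambda>x. 0)"
  shows "\<exists>\<xi>. fourier f \<xi> \<noteq> 0"
  using assms PW1_inversion[OF assms(1)] by fastforce

lemma sign_radius_PW1:
  assumes f: "f \<in> PW1" "f \<noteq> (\<lambda>x. 0)" "fourier f 0 = 0"
    and r: "r > 0" and sign: "\<And>x. \<bar>x\<bar> \<ge> r \<Longrightarrow> f x \<ge> 0"
  shows "r \<ge> 1 / 8"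
proof (rule sign_radius_ge[OF PW1_D(2)[OF f(1)] _ _ _ r sign])
  show "(LINT x|lborel. f x) = 0" using f(3) by (simp add: fourier_zero_eq_mean)
  show "\<bar>f x\<bar> \<le> 2 * (LINT x|lborel. \<bar>f x\<bar>)" for x
    by (rule bandlimited_sup_bound) (use PW1_D[OF f(1)] PW1_inversion[OF f(1)] in auto)
  show "(LINT x|lborel. \<bar>f x\<bar>) \<noteq> 0"
    using fourier_eq_0_if_norm_0[OF PW1_D(2)[OF f(1)]] PW1_fourier_nonzero[OF f(1,2)] by auto
qed

text \<open>Inversion is applied on the frequency side, to \<open>hilbert_fourier f\<close>: its
  transform is the reflected \<open>hilbert f\<close>, which is integrable by \<open>H\<close>.
  Inverting then recovers the multiplier formula at every \<open>\<xi>\<close>.\<close>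

lemma fourier_hilbert:
  assumes f: "f \<in> PW1" "fourier f 0 = 0" and H: "integrable lborel (hilbert f)"
  shows "fourier (hilbert f) \<xi> = hilbert_fourier f \<xi>"
proof -
  note pw = PW1_D[OF f(1)]
  have [measurable]: "fourier f \<in> borel_measurable borel"
    using borel_measurable_integrable[OF pw(5)] by simp
  have n: "norm (hilbert_fourier f \<xi>) \<le> norm (fourier f \<xi>)" for \<xi>
    by (auto simp: hilbert_fourier_def norm_mult abs_sgn_eq)
  have int: "integrable lborel (hilbert_fourier f)"
    by (rule Bochner_Integration.integrable_bound[OF pw(5)])
      (use n in \<open>auto simp: hilbert_fourier_def[abs_def]\<close>)
  have "isCont (hilbert_fourier f) \<xi>" for \<xi>
  \<comment> \<open>The jump of \<open>sgn\<close> at 0 is harmless because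
    \<open>fourier f 0 = 0\<close>.\<close>
  proof (cases "\<xi> = 0")
    case True
    have "isCont (fourier f) 0" using pw(4) by (simp add: continuous_on_eq_continuous_at)
    then have "((\<lambda>\<xi>. norm (fourier f \<xi>)) \<longlongrightarrow> 0) (at 0)"
      using f(2) by (auto simp: isCont_def dest: tendsto_norm)
    then have "(hilbert_fourier f \<longlongrightarrow> 0) (at 0)"
      by (rule Lim_null_comparison[rotated]) (use n in auto)
    then show ?thesis using True by (simp add: isCont_def hilbert_fourier_def)
  next
    case False
    have "isCont (fourier f) \<xi>" using pw(4) by (simp add: continuous_on_eq_continuous_at)
    then show ?thesis unfolding hilbert_fourier_def[abs_def]
      using False by (intro continuous_intros) auto
  qed
  then have cont: "continuous_on UNIV (hilbert_fourier f)" by (simp add: continuous_at_imp_continuous_on)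
  have ft: "complex_fourier (hilbert_fourier f) x = complex_of_real (hilbert f (- x))" for x
    unfolding PW1_hilbert[OF f(1)] complex_fourier_def
    by (intro Bochner_Integration.integral_cong) (auto simp: mult_ac)
  have "hilbert_fourier f \<xi> = (LINT x|lborel. complex_of_real (hilbert f (- x)) * cis (2 * pi * \<xi> * x))"
    unfolding ft[symmetric]
  proof (rule fourier_inversion[OF int cont])
    show "integrable lborel (complex_fourier (hilbert_fourier f))"
      unfolding ft[abs_def] using lborel_integrable_real_affine[OF H, of "-1" 0] by simp
  qed
  also have "\<dots> = fourier (hilbert f) \<xi>"
    unfolding fourier_def
    by (subst lborel_integral_real_affine[where c="-1" and t=0]) (auto simp: mult_ac)
  finally show ?thesis by simp
qed

lemma sign_radius_hilbert:
  assumes f: "f \<in> PW1" "f \<noteq> (\<lambda>x. 0)" "fourier f 0 = 0" and H: "integrable lborel (hilbert f)"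
    and s: "s \<in> {1, -1}" and r: "r > 0" and sign: "\<And>x. \<bar>x\<bar> \<ge> r \<Longrightarrow> s * hilbert f x \<ge> 0"
  shows "r \<ge> 1 / 8"
proof (rule sign_radius_ge[where g="\<lambda>x. s * hilbert f x", OF _ _ _ _ r sign])
  note FH = fourier_hilbert[OF f(1,3) H]
  have abs: "\<bar>s * hilbert f x\<bar> = \<bar>hilbert f x\<bar>" for x using s by auto
  show "integrable lborel (\<lambda>x. s * hilbert f x)" using H by simp
  \<comment> \<open>The mean is the transform at 0, where the multiplier vanishes.\<close>
  have "(LINT x|lborel. hilbert f x) = 0"
    using FH[of 0] by (simp add: fourier_zero_eq_mean hilbert_fourier_def)
  then show "(LINT x|lborel. s * hilbert f x) = 0" by simp
  have fe: "fourier (hilbert f) = hilbert_fourier f" using FH by auto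
  have "integrable lborel (fourier (hilbert f))"
  proof (rule Bochner_Integration.integrable_bound[OF PW1_D(5)[OF f(1)]])
    show "fourier (hilbert f) \<in> borel_measurable lborel"
      using continuous_complex_fourier[of "\<lambda>x. complex_of_real (hilbert f x)"] H
      by (simp add: fourier_eq_complex_fourier borel_measurable_continuous_onI)
  qed (auto simp: fe hilbert_fourier_def norm_mult abs_sgn_eq)
  then have "\<bar>hilbert f x\<bar> \<le> 2 * (LINT x|lborel. \<bar>hilbert f x\<bar>)" for x
    by (intro bandlimited_sup_bound H)
      (auto simp: fe PW1_hilbert[OF f(1)] hilbert_fourier_def PW1_D(3)[OF f(1)])
  then show "\<bar>s * hilbert f x\<bar> \<le> 2 * (LINT x|lborel. \<bar>s * hilbert f x\<bar>)" for x
    unfolding abs .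
  obtain \<xi> where \<xi>: "fourier f \<xi> \<noteq> 0" using PW1_fourier_nonzero[OF f(1,2)] by auto
  \<comment> \<open>Away from 0 the multiplier has modulus 1, so a nonzero value of the transform
    survives.\<close>
  with f(3) have "\<xi> \<noteq> 0" by auto
  with \<xi> have "fourier (hilbert f) \<xi> \<noteq> 0" by (simp add: fe hilbert_fourier_def sgn_eq_0_iff)
  then show "(LINT x|lborel. \<bar>s * hilbert f x\<bar>) \<noteq> 0"
    unfolding abs using fourier_eq_0_if_norm_0[OF H] by auto
qed

section \<open>The constant and the final estimate\<close>

text \<open>The angle \<open>pi / (2 * p)\<close> crosses \<open>pi / 4\<close> exactly at
  \<open>p = 2\<close>, where the definition switches from tangent to cotangent.\<close>

lemma Cconst_ge_1:
  assumes "1 < p" shows "Cconst p \<ge> 1"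
proof (cases "p \<le> 2")
  case True
  have "tan (pi / 4) \<le> tan (pi / (2 * p))"
    using assms True by (intro tan_mono_le) (auto simp: field_simps)
  then show ?thesis using True by (simp add: Cconst_def tan_45)
next
  case False
  have "tan (pi / (2 * p)) \<le> tan (pi / 4)"
  proof (rule tan_mono_le)
    have "0 < pi / (2 * p)" using False by simp
    then show "- (pi / 2) < pi / (2 * p)" using pi_gt_zero by linarith
  qed (use False in \<open>auto simp: field_simps\<close>)
  moreover have "tan (pi / (2 * p)) > 0"
    using False by (intro tan_gt_zero) (auto simp: field_simps)
  ultimately have "1 \<le> 1 / tan (pi / (2 * p))" by (simp add: tan_45)
  then show ?thesis using False by (simp add: Cconst_def cot_altdef inverse_eq_divide)
qed

theorem mainTheorem19:
  fixes f :: "real \<Rightarrow> real" and s p r1 r2 :: real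
  assumes "s \<in> {1, -1}"
    and "1 < p"
    and "f \<in> PW1"
    and "f \<noteq> (\<lambda>x. 0)"
    and "fourier f 0 = 0"
    and "integrable lborel (hilbert f)"
    and "r1 > 0" and "r2 > 0"
    and "\<And>y. \<bar>y\<bar> \<ge> r1 \<Longrightarrow> f y \<ge> 0"
    and "\<And>x. \<bar>x\<bar> \<ge> r2 \<Longrightarrow> s * hilbert f x \<ge> 0"
  shows "r1 powr (1 / (p / (p - 1))) * r2 powr (1 / p)
           \<ge> 2 powr (- (p / (p - 1) + 2)) * Cconst p powr (- ((p + 1) / (p - 1)))"
proof -
  note p = \<open>1 < p\<close>
  have r: "1 / 8 \<le> r1" "1 / 8 \<le> r2"
    using sign_radius_PW1[of f r1] sign_radius_hilbert[of f s r2] assms by auto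
  \<comment> \<open>As p' is at least 1, the power of 2 is at most \<open>2 powr (-3)\<close>, that
    is 1/8; \<open>Cconst p\<close> is at least 1 and its exponent is negative.\<close>
  have "2 powr (- (p / (p - 1) + 2)) * Cconst p powr (- ((p + 1) / (p - 1))) \<le> 2 powr (-3) * 1"
  proof (rule mult_mono)
    have "1 \<le> p / (p - 1)" using p by (simp add: field_simps)
    then show "2 powr (- (p / (p - 1) + 2)) \<le> 2 powr (-3 :: real)" by simp
    have "Cconst p powr (- ((p + 1) / (p - 1))) \<le> Cconst p powr 0"
      using p Cconst_ge_1[OF p] by (intro powr_mono) auto
    then show "Cconst p powr (- ((p + 1) / (p - 1))) \<le> 1" using Cconst_ge_1[OF p] by simp
  qed auto
  \<comment> \<open>The exponents 1/p' and 1/p add up to 1, so 1/8 splits into one factor for each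
    radius.\<close>
  also have "2 powr (-3) * 1 = (1 / 8 :: real) powr (1 / (p / (p - 1)) + 1 / p)"
  proof -
    have "1 / (p / (p - 1)) + 1 / p = 1" using p by (simp add: field_simps)
    moreover have "2 powr (-3 :: real) = 1 / 8" by (simp add: powr_minus powr_numeral divide_simps)
    ultimately show ?thesis by simp
  qed
  also have "\<dots> \<le> r1 powr (1 / (p / (p - 1))) * r2 powr (1 / p)"
    unfolding powr_add using p r by (intro mult_mono powr_mono2) auto
  finally show ?thesis .
qed

end
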